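(* For $\alpha\in(0,1)\cup(1,2)$, the linear span of the set $\{{}_{\mathcal H}\mathcal M^\alpha_-1_{(a,b)}:\ a,b\in\mathbb R^+,\ a<b\}$ is dense in $L_2(\mathbb R^+)$.
   Context: $\mathbb R^+=(0,\infty)$; functions are real-valued. For $\beta>0$ the right-sided Hadamard integral is $$({}_{\mathcal H}\mathcal I^\beta_-f)(t)=\frac1{\Gamma(\beta)}\int_t^\infty\Big(\log\frac zt\Big)^{\beta-1}\frac{f(z)}{z}\,dz,\qquad t>0,$$ and for $\beta\in(0,1)$ the right-sided Hadamard derivative is $({}_{\mathcal H}\mathcal D^\beta_-f)(t)=-t\frac{d}{dt}({}_{\mathcal H}\mathcal I^{1-\beta}_-f)(t)$, $t>0$. With $K_\alpha=\Gamma((\alpha+1)/2)/\sqrt{\Gamma(\alpha)}$, the operator ${}_{\mathcal H}\mathcal M^\alpha_-$ is $${}_{\mathcal H}\mathcal M^\alpha_-f=K_\alpha\,{}_{\mathcal H}\mathcal D^{(1-\alpha)/2}_-f\ \ (\alpha\in(0,1)),\qquad {}_{\mathcal H}\mathcal M^\alpha_-f=K_\alpha\,{}_{\mathcal H}\mathcal I^{(\alpha-1)/2}_-f\ \ (\alpha\in(1,2)).$$ It is known that, for almost every $x>0$ and $0\le a<b$, $$({}_{\mathcal H}\mathcal M^\alpha_-1_{(a,b)})(x)=\frac1{\sqrt{\Gamma(\alpha)}}\Big[\Big(\log\frac bx\Big)_+^{(\alpha-1)/2}-\Big(\log\frac ax\Big)_+^{(\alpha-1)/2}\Big],$$ where $(y)_+^{\gamma}=y^\gamma$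 for $y>0$ and $0$ otherwise, and that this function belongs to $L_2(\mathbb R^+)$. *)

theory Defs
  imports "HOL-Analysis.Analysis"
begin

abbreviation Rpos :: "real measure"
  where "Rpos \<equiv> lebesgue_on {0<..}"

definition square_integrable :: "(real \<Rightarrow> real) \<Rightarrow> bool"
  where "square_integrable f \<longleftrightarrow>
    f \<in> borel_measurable Rpos \<and> integrable Rpos (\<lambda>x. (f x)\<^sup>2)"

lemma square_integrable_mult:
  assumes "square_integrable f" "square_integrable g"
  shows "integrable Rpos (\<lambda>x. f x * g x)"
proof (rule Bochner_Integration.integrable_bound)
  show "integrable Rpos (\<lambda>x. (f x)\<^sup>2 + (g x)\<^sup>2)"
    using assms by (simp add: square_integrable_def)
  show "(\<lambda>x. f x * g x) \<in> borel_measurable Rpos"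
    using assms by (auto simp: square_integrable_def)
  have "\<bar>u * v\<bar> \<le> u\<^sup>2 + v\<^sup>2" for u v :: real
  proof -
    have "2 * \<bar>u\<bar> * \<bar>v\<bar> \<le> \<bar>u\<bar>\<^sup>2 + \<bar>v\<bar>\<^sup>2"
      by (rule sum_squares_bound)
    moreover have "0 \<le> \<bar>u\<bar> * \<bar>v\<bar>"
      by simp
    ultimately show ?thesis
      unfolding abs_mult power2_abs by linarith
  qed
  then show "AE x in Rpos. norm (f x * g x) \<le> norm ((f x)\<^sup>2 + (g x)\<^sup>2)"
    by (auto intro!: AE_I2)
qed

lemma square_integrable_zero: "square_integrable (\<lambda>x. 0)"
  by (simp add: square_integrable_def)

lemma square_integrable_add:
  assumes "square_integrable f" "square_integrable g"
  shows "square_integrable (\<lambda>x. f x + g x)"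
  using assms square_integrable_mult[OF assms]
  by (auto simp: square_integrable_def power2_sum mult.assoc)

lemma square_integrable_scale:
  assumes "square_integrable f"
  shows "square_integrable (\<lambda>x. c * f x)"
  using assms by (auto simp: square_integrable_def power_mult_distrib)

lemma square_integrable_minus:
  assumes "square_integrable f"
  shows "square_integrable (\<lambda>x. - f x)"
  using square_integrable_scale[OF assms, of "-1"] by simp

lemma square_integrable_diff:
  assumes "square_integrable f" "square_integrable g"
  shows "square_integrable (\<lambda>x. f x - g x)"
  using square_integrable_add[OF assms(1) square_integrable_minus[OF assms(2)]] by simp

definition L2_rel :: "(real \<Rightarrow> real) \<Rightarrow> (real \<Rightarrow> real) \<Rightarrow> bool"
  where "L2_rel f g \<longleftrightarrow>
    square_integrable f \<and> square_integrable g \<and> (AE x in Rpos. f x = g x)"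

lemma part_equivp_L2_rel: "part_equivp L2_rel"
proof (rule part_equivpI)
  show "\<exists>f. L2_rel f f"
    using square_integrable_zero by (auto simp: L2_rel_def)
  show "symp L2_rel"
    by (auto simp: symp_def L2_rel_def eq_commute)
  show "transp L2_rel"
  proof (rule transpI)
    fix f g h assume *: "L2_rel f g" "L2_rel g h"
    then have "AE x in Rpos. f x = g x" "AE x in Rpos. g x = h x"
      by (simp_all add: L2_rel_def)
    then have "AE x in Rpos. f x = h x"
      by eventually_elim simp
    with * show "L2_rel f h"
      by (simp add: L2_rel_def)
  qed
qed

text \<open>The Hilbert space of square integrable real functions on the positive half-line with
  respect to Lebesgue measure, as a type of classes modulo almost everywhere equality. The class
  map \<open>L2_class\<close> is meaningful only on square integrable functions.\<close>

quotient_type L2_Rpos = "real \<Rightarrow> real" / partial: L2_rel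
  morphisms L2_rep L2_class
  by (rule part_equivp_L2_rel)

instantiation L2_Rpos :: real_inner
begin

lift_definition zero_L2_Rpos :: L2_Rpos is "\<lambda>x. 0"
  by (simp add: L2_rel_def square_integrable_zero)

lift_definition plus_L2_Rpos :: "L2_Rpos \<Rightarrow> L2_Rpos \<Rightarrow> L2_Rpos" is "\<lambda>f g x. f x + g x"
  by (auto simp: L2_rel_def square_integrable_add)

lift_definition uminus_L2_Rpos :: "L2_Rpos \<Rightarrow> L2_Rpos" is "\<lambda>f x. - f x"
  by (auto simp: L2_rel_def square_integrable_minus)

lift_definition minus_L2_Rpos :: "L2_Rpos \<Rightarrow> L2_Rpos \<Rightarrow> L2_Rpos" is "\<lambda>f g x. f x - g x"
  by (auto simp: L2_rel_def square_integrable_diff)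

lift_definition scaleR_L2_Rpos :: "real \<Rightarrow> L2_Rpos \<Rightarrow> L2_Rpos" is "\<lambda>c f x. c * f x"
  by (auto simp: L2_rel_def square_integrable_scale)

lift_definition inner_L2_Rpos :: "L2_Rpos \<Rightarrow> L2_Rpos \<Rightarrow> real"
  is "\<lambda>f g. LINT x|Rpos. f x * g x"
  unfolding L2_rel_def square_integrable_def
  by (intro integral_cong_AE) auto

definition norm_L2_Rpos :: "L2_Rpos \<Rightarrow> real"
  where "norm_L2_Rpos f = sqrt (inner f f)"

definition dist_L2_Rpos :: "L2_Rpos \<Rightarrow> L2_Rpos \<Rightarrow> real"
  where "dist_L2_Rpos f g = norm (f - g)"

definition sgn_L2_Rpos :: "L2_Rpos \<Rightarrow> L2_Rpos"
  where "sgn_L2_Rpos f = inverse (norm f) *\<^sub>R f"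

definition uniformity_L2_Rpos :: "(L2_Rpos \<times> L2_Rpos) filter"
  where "uniformity_L2_Rpos = (INF e\<in>{0<..}. principal {(f, g). dist f g < e})"

definition open_L2_Rpos :: "L2_Rpos set \<Rightarrow> bool"
  where "open_L2_Rpos U \<longleftrightarrow>
    (\<forall>f\<in>U. eventually (\<lambda>(f', g). f' = f \<longrightarrow> g \<in> U) uniformity)"

instance
proof
  fix f g h :: L2_Rpos and a b :: real
  show "f + g + h = f + (g + h)"
    by transfer (auto simp: L2_rel_def add.assoc intro!: square_integrable_add)
  show "f + g = g + f"
    by transfer (auto simp: L2_rel_def add.commute intro!: square_integrable_add)
  show "0 + f = f"
    by transfer (auto simp: L2_rel_def)
  show "- f + f = 0"
    by transfer (auto simp: L2_rel_def square_integrable_zero)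
  show "f - g = f + - g"
    by transfer (auto simp: L2_rel_def intro!: square_integrable_diff)
  show "a *\<^sub>R (f + g) = a *\<^sub>R f + a *\<^sub>R g"
    by transfer (auto simp: L2_rel_def distrib_left intro!: square_integrable_add square_integrable_scale)
  show "(a + b) *\<^sub>R f = a *\<^sub>R f + b *\<^sub>R f"
    by transfer (auto simp: L2_rel_def distrib_right intro!: square_integrable_add square_integrable_scale)
  show "a *\<^sub>R b *\<^sub>R f = (a * b) *\<^sub>R f"
    by transfer (auto simp: L2_rel_def mult.assoc intro!: square_integrable_scale)
  show "1 *\<^sub>R f = f"
    by transfer (auto simp: L2_rel_def)
  show "dist f g = norm (f - g)"
    by (rule dist_L2_Rpos_def)
  show "sgn f = inverse (norm f) *\<^sub>R f"
    by (rule sgn_L2_Rpos_def)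
  show "uniformity = (INF e\<in>{0<..}. principal {(f, g :: L2_Rpos). dist f g < e})"
    by (rule uniformity_L2_Rpos_def)
  show "open U \<longleftrightarrow> (\<forall>f\<in>U. eventually (\<lambda>(f', g). f' = f \<longrightarrow> g \<in> U) uniformity)"
    for U :: "L2_Rpos set"
    by (rule open_L2_Rpos_def)
  show "inner f g = inner g f"
    by transfer (simp add: mult.commute)
  show "inner (f + g) h = inner f h + inner g h"
    by transfer (simp add: L2_rel_def distrib_right square_integrable_mult)
  show "inner (a *\<^sub>R f) g = a * inner f g"
    by transfer (simp add: mult.assoc)
  show "0 \<le> inner f f"
    by transfer simp
  show "inner f f = 0 \<longleftrightarrow> f = 0"
    by transfer (auto simp: L2_rel_def square_integrable_zero square_integrable_def
        power2_eq_square integral_nonneg_eq_0_iff_AE)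
  show "norm f = sqrt (inner f f)"
    by (rule norm_L2_Rpos_def)
qed

end

definition hadamard_integral :: "real \<Rightarrow> (real \<Rightarrow> real) \<Rightarrow> real \<Rightarrow> real"
  where "hadamard_integral \<beta> f t =
    1 / Gamma \<beta> * (LINT z:{t<..}|lebesgue. ln (z / t) powr (\<beta> - 1) * (f z / z))"

definition hadamard_derivative :: "real \<Rightarrow> (real \<Rightarrow> real) \<Rightarrow> real \<Rightarrow> real"
  where "hadamard_derivative \<beta> f t = - t * deriv (hadamard_integral (1 - \<beta>) f) t"

definition hadamard_const :: "real \<Rightarrow> real"
  where "hadamard_const \<alpha> = Gamma ((\<alpha> + 1) / 2) / sqrt (Gamma \<alpha>)"

text \<open>Only for \<open>\<alpha>\<close> in \<open>(0,1)\<close> or \<open>(1,2)\<close>. The value where \<^const>\<open>deriv\<close> does not exist is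
  unspecified; for the indicator of \<open>(a, b)\<close> this concerns at most the points \<open>a\<close> and \<open>b\<close>.\<close>

definition hadamard_M :: "real \<Rightarrow> (real \<Rightarrow> real) \<Rightarrow> real \<Rightarrow> real"
  where "hadamard_M \<alpha> f t =
    (if \<alpha> < 1 then hadamard_const \<alpha> * hadamard_derivative ((1 - \<alpha>) / 2) f t
     else hadamard_const \<alpha> * hadamard_integral ((\<alpha> - 1) / 2) f t)"

end

theory Submission
  imports Defs
begin

text \<open>
  Let \<open>\<gamma> = (\<alpha> - 1) / 2\<close>, which lies in \<open>(-1/2, 1/2)\<close>, and write \<open>E\<^sub>s\<close> for the function
  \<open>x \<mapsto> (s - ln x)\<^sub>+\<^sup>\<gamma>\<close>, called \<open>log_power \<gamma> s\<close> below. By the fundamental theorem of calculus, the operator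
  maps the indicator of \<open>(a, b)\<close> to a nonzero multiple of \<open>E\<^sub>s - E\<^sub>r\<close> with \<open>s = ln b\<close> and \<open>r = ln a\<close>
  (\<open>hadamard_M_indicator\<close>), and \<open>E\<^sub>s\<close> is square integrable since \<open>2 * \<gamma> > -1\<close>.

  The space is complete (Riesz--Fischer), so it is enough to show that a function \<open>g\<close> orthogonal to all
  these differences vanishes (\<open>closure_span_eq_UNIV_if_orthogonal_trivial\<close>). For such \<open>g\<close> the inner
  product with \<open>E\<^sub>s\<close> does not depend on \<open>s\<close>. The squared norm of \<open>E\<^sub>s\<close> is proportional to \<open>exp s\<close>, so
  \<open>s \<rightarrow> -\<infinity>\<close> shows that \<open>g\<close> is orthogonal to every \<open>E\<^sub>s\<close>.

  The functions \<open>E\<^sub>s\<close> determine \<open>g\<close>, because truncated powers form a semigroup under convolution in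
  \<open>s\<close> (Euler's Beta integral): integrating \<open>E\<^sub>v\<close> against \<open>(s - v)\<^sub>+\<^bsup>-\<gamma>\<^esup>\<close> over \<open>v\<close> gives a positive multiple
  of \<open>(s - ln x)\<^sub>+\<close>. By Fubini's theorem \<open>g\<close> is orthogonal to all functions \<open>(s - ln x)\<^sub>+\<close>, and
  taking difference quotients in \<open>s\<close> also to the indicators of \<open>(0, c]\<close>. Hence \<open>g\<close> is zero almost
  everywhere (\<open>log_powers_total\<close>). Passing through the exponent \<open>1\<close> treats both signs of \<open>\<gamma>\<close> alike.
\<close>

section \<open>Completeness of the square integrable functions\<close>

lemma geometric_increments_distance_to_limit:
  fixes a :: "nat \<Rightarrow> real"
  assumes step: "\<And>k. \<bar>a (Suc k) - a k\<bar> \<le> c * q ^ k" and q: "0 \<le> q" "q < 1"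
  shows "\<bar>lim a - a k\<bar> \<le> c / (1 - q) * q ^ k"
proof -
  have "summable (\<lambda>k. c * q ^ k)"
    using q by (intro summable_mult summable_geometric) auto
  then have "summable (\<lambda>k. a (Suc k) - a k)"
    by (rule summable_comparison_test'[where N = 0]) (use step in simp)
  then have "convergent (\<lambda>n. \<Sum>k<n. a (Suc k) - a k)"
    by (simp add: summable_iff_convergent)
  then have "convergent (\<lambda>n. (a n - a 0) + a 0)"
    unfolding sum_lessThan_telescope by (intro convergent_add convergent_const)
  then have lim: "a \<longlonglongrightarrow> lim a"
    by (simp add: convergent_LIMSEQ_iff)
  have c: "0 \<le> c"
    using step[of 0] by simp
  have "\<bar>a (m + k) - a k\<bar> \<le> c / (1 - q) * q ^ k * (1 - q ^ m)" for m
  proof (induction m)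
    case (Suc m)
    have "\<bar>a (Suc m + k) - a k\<bar> \<le> c * q ^ (m + k) + c / (1 - q) * q ^ k * (1 - q ^ m)"
      using Suc.IH step[of "m + k"] by simp
    also have "\<dots> = c / (1 - q) * q ^ k * (1 - q ^ Suc m)"
      using q by (simp add: field_simps power_add)
    finally show ?case .
  qed simp
  also have "\<dots> m \<le> c / (1 - q) * q ^ k" for m
    using c q by (intro mult_left_le) auto
  finally have "\<bar>a (m + k) - a k\<bar> \<le> c / (1 - q) * q ^ k" for m .
  moreover have "(\<lambda>m. \<bar>a (m + k) - a k\<bar>) \<longlonglongrightarrow> \<bar>lim a - a k\<bar>"
    by (intro tendsto_intros LIMSEQ_ignore_initial_segment lim)
  ultimately show "\<bar>lim a - a k\<bar> \<le> c / (1 - q) * q ^ k"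
    by (intro LIMSEQ_le_const2) auto
qed

lemma square_integrable_L2_rep: "square_integrable (L2_rep X)"
  and L2_class_L2_rep: "L2_class (L2_rep X) = X"
proof -
  show "square_integrable (L2_rep X)"
    using Quotient3_rep_reflp[OF Quotient3_L2_Rpos] by (auto simp: L2_rel_def)
  show "L2_class (L2_rep X) = X"
    by (rule Quotient3_abs_rep[OF Quotient3_L2_Rpos])
qed

lemma inner_L2_class:
  assumes "square_integrable f" "square_integrable g"
  shows "inner (L2_class f) (L2_class g) = (LINT x|Rpos. f x * g x)"
  using assms by (intro inner_L2_Rpos.abs_eq) (auto simp: L2_rel_def eq_onp_def)

lemma L2_class_diff:
  assumes "square_integrable f" "square_integrable g"
  shows "L2_class f - L2_class g = L2_class (\<lambda>x. f x - g x)"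
  using assms by (intro minus_L2_Rpos.abs_eq) (auto simp: L2_rel_def eq_onp_def)

lemma L2_class_scale:
  assumes "square_integrable f"
  shows "c *\<^sub>R L2_class f = L2_class (\<lambda>x. c * f x)"
  using assms by (intro scaleR_L2_Rpos.abs_eq) (auto simp: L2_rel_def eq_onp_def)

lemma norm_L2_class:
  assumes "square_integrable f"
  shows "(norm (L2_class f))\<^sup>2 = (LINT x|Rpos. (f x)\<^sup>2)"
  using inner_L2_class[OF assms assms]
  by (simp add: power2_norm_eq_inner) (simp add: power2_eq_square)

lemma L2_class_eqI:
  assumes "square_integrable f" "square_integrable g" "AE x in Rpos. f x = g x"
  shows "L2_class f = L2_class g"
  using assms by (intro Quotient3_rel_abs[OF Quotient3_L2_Rpos]) (auto simp: L2_rel_def)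

text \<open>
  The core of the Riesz--Fischer theorem. Weighting the squared increments by \<open>2 ^ k\<close> gives a series
  \<open>T\<close> that still has finite integral, and a single finite value \<open>T x\<close> makes all increments at \<open>x\<close>
  geometrically small. So the pointwise limit exists almost everywhere, and \<open>T\<close> also
  controls the integral of the squared error.
\<close>

lemma square_integrable_geometric_limit:
  assumes sq: "\<And>k. square_integrable (h k)"
  assumes step: "\<And>k. (LINT x|Rpos. (h (Suc k) x - h k x)\<^sup>2) \<le> (1/4) ^ k"
  obtains f C where "square_integrable f"
    "\<And>k. (LINT x|Rpos. (f x - h k x)\<^sup>2) \<le> C * (1/2) ^ k"
proof -
  define T where "T x = (\<Sum>k. ennreal (2 ^ k * (h (Suc k) x - h k x)\<^sup>2))" for x
  define \<tau> where "\<tau> x = enn2real (T x)" for x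
  define q :: real where "q = sqrt (1/2)"
  define f where "f x = lim (\<lambda>k. h k x)" for x
  have q: "0 \<le> q" "q < 1"
    by (simp_all add: q_def real_sqrt_divide)
  have [measurable]: "h k \<in> borel_measurable Rpos" for k
    using sq by (simp add: square_integrable_def)
  have [measurable]: "T \<in> borel_measurable Rpos" "\<tau> \<in> borel_measurable Rpos"
      "f \<in> borel_measurable Rpos"
    unfolding T_def[abs_def] \<tau>_def[abs_def] f_def[abs_def] by measurable
  have int: "integrable Rpos (\<lambda>x. (h (Suc k) x - h k x)\<^sup>2)" for k
    using square_integrable_diff[OF sq sq] by (simp add: square_integrable_def)
  have "(\<integral>\<^sup>+x. ennreal (2 ^ k * (h (Suc k) x - h k x)\<^sup>2) \<partial>Rpos) \<le> ennreal ((1/2) ^ k)" for k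
  proof -
    have "(\<integral>\<^sup>+x. ennreal (2 ^ k * (h (Suc k) x - h k x)\<^sup>2) \<partial>Rpos) =
        ennreal (LINT x|Rpos. 2 ^ k * (h (Suc k) x - h k x)\<^sup>2)"
      using int by (intro nn_integral_eq_integral) auto
    also have "\<dots> \<le> ennreal (2 ^ k * (1/4) ^ k)"
      using step by (intro ennreal_leI) simp
    also have "(2::real) ^ k * (1/4) ^ k = (1/2) ^ k"
      by (simp flip: power_mult_distrib)
    finally show ?thesis .
  qed
  then have "(\<integral>\<^sup>+x. T x \<partial>Rpos) \<le> (\<Sum>k. ennreal ((1/2) ^ k))"
    unfolding T_def by (subst nn_integral_suminf) (auto intro!: suminf_le)
  also have "\<dots> = ennreal (\<Sum>k. (1/2) ^ k)"
    by (intro suminf_ennreal2) (auto intro: summable_geometric)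
  finally have T_fin: "(\<integral>\<^sup>+x. T x \<partial>Rpos) < \<infinity>"
    by (rule order.strict_trans1) simp
  then have AE_T: "AE x in Rpos. T x \<noteq> \<infinity>"
    by (intro nn_integral_PInf_AE) auto
  have int_\<tau>: "integrable Rpos \<tau>"
  proof (rule integrableI_bounded)
    have "(\<integral>\<^sup>+x. ennreal (norm (\<tau> x)) \<partial>Rpos) = (\<integral>\<^sup>+x. T x \<partial>Rpos)"
      using AE_T by (intro nn_integral_cong_AE) (auto simp: \<tau>_def ennreal_enn2real_if)
    with T_fin show "(\<integral>\<^sup>+x. ennreal (norm (\<tau> x)) \<partial>Rpos) < \<infinity>"
      by simp
  qed measurable
  have bound: "AE x in Rpos. (f x - h k x)\<^sup>2 \<le> \<tau> x / (1 - q)\<^sup>2 * (1/2) ^ k" for k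
    using AE_T
  proof eventually_elim
    case (elim x)
    have \<tau>0: "0 \<le> \<tau> x"
      by (simp add: \<tau>_def)
    have inc: "\<bar>h (Suc k) x - h k x\<bar> \<le> sqrt (\<tau> x) * q ^ k" for k
    proof -
      have "ennreal (2 ^ k * (h (Suc k) x - h k x)\<^sup>2) \<le> T x"
      proof -
        have "sum F {k} \<le> suminf F" for F :: "nat \<Rightarrow> ennreal"
          by (rule sum_le_suminf) auto
        from this[of "\<lambda>k. ennreal (2 ^ k * (h (Suc k) x - h k x)\<^sup>2)"] show ?thesis
          by (simp only: T_def sum.insert_remove sum.empty finite.emptyI empty_Diff add_0_right)
      qed
      also have "T x = ennreal (\<tau> x)"
        using elim by (simp add: \<tau>_def ennreal_enn2real_if)
      finally have "2 ^ k * (h (Suc k) x - h k x)\<^sup>2 \<le> \<tau> x"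
        using \<tau>0 by simp
      then have "(h (Suc k) x - h k x)\<^sup>2 \<le> \<tau> x * (1/2) ^ k"
        by (simp add: field_simps)
      then have "sqrt ((h (Suc k) x - h k x)\<^sup>2) \<le> sqrt (\<tau> x * (1/2) ^ k)"
        by (rule real_sqrt_le_mono)
      then show ?thesis
        unfolding q_def real_sqrt_abs unfolding real_sqrt_mult real_sqrt_power .
    qed
    have "\<bar>f x - h k x\<bar> \<le> sqrt (\<tau> x) / (1 - q) * q ^ k"
      unfolding f_def by (rule geometric_increments_distance_to_limit[OF inc q])
    then have "(f x - h k x)\<^sup>2 \<le> (sqrt (\<tau> x) / (1 - q) * q ^ k)\<^sup>2"
      using abs_le_square_iff order_trans[OF _ abs_ge_self] by blast
    also have "\<dots> = \<tau> x / (1 - q)\<^sup>2 * (1/2) ^ k"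
    proof -
      have "(q ^ k)\<^sup>2 = (1/2) ^ k"
        unfolding q_def power_mult[symmetric] mult.commute[of k] by (simp add: power_mult)
      with \<tau>0 show ?thesis
        by (simp add: power_mult_distrib power_divide)
    qed
    finally show ?case .
  qed
  have int_diff: "integrable Rpos (\<lambda>x. (f x - h k x)\<^sup>2)" for k
  proof (rule Bochner_Integration.integrable_bound)
    show "integrable Rpos (\<lambda>x. \<tau> x / (1 - q)\<^sup>2 * (1/2) ^ k)"
      using int_\<tau> by simp
    show "AE x in Rpos. norm ((f x - h k x)\<^sup>2) \<le> norm (\<tau> x / (1 - q)\<^sup>2 * (1/2) ^ k)"
      using bound[of k] by eventually_elim (simp add: \<tau>_def)
  qed measurable
  show thesis
  proof
    have "square_integrable (\<lambda>x. f x - h 0 x)"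
      using int_diff[of 0] by (auto simp: square_integrable_def)
    from square_integrable_add[OF this sq[of 0]] show "square_integrable f"
      by simp
    show "(LINT x|Rpos. (f x - h k x)\<^sup>2) \<le> (LINT x|Rpos. \<tau> x / (1 - q)\<^sup>2) * (1/2) ^ k" for k
    proof -
      have "(LINT x|Rpos. (f x - h k x)\<^sup>2) \<le> (LINT x|Rpos. \<tau> x / (1 - q)\<^sup>2 * (1/2) ^ k)"
        using int_diff int_\<tau> bound by (intro integral_mono_AE) auto
      then show ?thesis
        by simp
    qed
  qed
qed

text \<open>
  The indices \<open>M k\<close> are so large that the increments of \<open>X \<circ> M\<close> decay geometrically; the limit of
  \<open>X \<circ> M\<close> is then the limit of the Cauchy sequence \<open>X\<close>.
\<close>

instance L2_Rpos :: complete_space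
proof
  fix X :: "nat \<Rightarrow> L2_Rpos"
  assume "Cauchy X"
  then have "\<exists>N. \<forall>m\<ge>N. \<forall>n\<ge>N. dist (X m) (X n) < (1/2) ^ k" for k
    unfolding Cauchy_def by simp
  then obtain N where N: "\<And>k m n. N k \<le> m \<Longrightarrow> N k \<le> n \<Longrightarrow> dist (X m) (X n) < (1/2) ^ k"
    by metis
  define M where "M k = (\<Sum>i\<le>k. N i)" for k
  have NM: "N k \<le> M k" "M k \<le> M (Suc k)" for k
    unfolding M_def by (auto intro: member_le_sum)
  define h where "h k = L2_rep (X (M k))" for k
  have sq: "square_integrable (h k)" and class_h: "L2_class (h k) = X (M k)" for k
    by (simp_all add: h_def square_integrable_L2_rep L2_class_L2_rep)
  have "(LINT x|Rpos. (h (Suc k) x - h k x)\<^sup>2) \<le> (1/4) ^ k" for k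
  proof -
    have "(LINT x|Rpos. (h (Suc k) x - h k x)\<^sup>2) = (dist (X (M (Suc k))) (X (M k)))\<^sup>2"
      by (simp add: dist_norm norm_L2_class L2_class_diff square_integrable_diff sq flip: class_h)
    also have "\<dots> \<le> ((1/2) ^ k)\<^sup>2"
      using NM[of k] by (intro power_mono less_imp_le[OF N]) auto
    also have "((1/2) ^ k)\<^sup>2 = (1/4 :: real) ^ k"
      unfolding power_mult[symmetric] mult.commute[of k] by (simp add: power_mult power2_eq_square)
    finally show ?thesis .
  qed
  from square_integrable_geometric_limit[OF sq this]
  obtain f C where f: "square_integrable f"
    and C: "\<And>k. (LINT x|Rpos. (f x - h k x)\<^sup>2) \<le> C * (1/2) ^ k"
    by metis
  have dist_f: "dist (X (M k)) (L2_class f) \<le> sqrt (C * (1/2) ^ k)" for k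
  proof (rule real_le_rsqrt)
    have "(dist (L2_class f) (X (M k)))\<^sup>2 = (LINT x|Rpos. (f x - h k x)\<^sup>2)"
      by (simp add: dist_norm norm_L2_class L2_class_diff square_integrable_diff sq f flip: class_h)
    then show "(dist (X (M k)) (L2_class f))\<^sup>2 \<le> C * (1/2) ^ k"
      using C[of k] by (simp add: dist_commute)
  qed
  have "(\<lambda>k. (1/2) ^ k + sqrt (C * (1/2) ^ k)) \<longlonglongrightarrow> 0 + sqrt (C * 0)"
    by (intro tendsto_intros LIMSEQ_power_zero) auto
  then have lim0: "(\<lambda>k. (1/2) ^ k + sqrt (C * (1/2) ^ k)) \<longlonglongrightarrow> 0"
    by simp
  have "X \<longlonglongrightarrow> L2_class f"
  proof (rule metric_LIMSEQ_I)
    fix e :: real assume "0 < e"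
    then obtain k where k: "(1/2) ^ k + sqrt (C * (1/2) ^ k) < e"
      using order_tendstoD(2)[OF lim0] by (auto simp: eventually_sequentially)
    have "dist (X n) (L2_class f) < e" if "N k \<le> n" for n
      using dist_triangle[of "X n" "L2_class f" "X (M k)"] N[OF that NM(1)] dist_f[of k] k
      by linarith
    then show "\<exists>no. \<forall>n\<ge>no. dist (X n) (L2_class f) < e"
      by blast
  qed
  then show "convergent X"
    by (rule convergentI)
qed

section \<open>Orthogonality and density in Hilbert spaces\<close>

text \<open>
  Hilbert's projection argument: by the parallelogram identity a minimizing sequence for the distance
  from an outside point \<open>x\<close> to \<open>W\<close> is Cauchy, and the error at its limit is orthogonal to \<open>W\<close>.
\<close>

lemma exists_orthogonal_to_proper_closed_subspace:
  fixes W :: "'a :: {real_inner, complete_space} set"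
  assumes W: "subspace W" "closed W" "W \<noteq> UNIV"
  obtains z where "z \<noteq> 0" "\<And>w. w \<in> W \<Longrightarrow> inner w z = 0"
proof -
  obtain x where x: "x \<notin> W"
    using W by auto
  have ne: "W \<noteq> {}"
    using W(1) subspace_0 by blast
  define d where "d = infdist x W"
  have d0: "0 \<le> d"
    by (simp add: d_def infdist_nonneg)
  have d: "d \<le> norm (x - w)" if "w \<in> W" for w
    using infdist_le[OF that, of x] by (simp add: d_def dist_norm)
  have "\<exists>w\<in>W. norm (x - w) < d + inverse (real (Suc n))" for n
  proof -
    have "(INF w\<in>W. dist x w) < d + inverse (real (Suc n))"
      using ne by (simp add: d_def infdist_def)
    moreover have "bdd_below (dist x ` W)"
      by (intro bdd_belowI[where m = 0]) auto
    ultimately show ?thesis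
      using ne by (auto simp: cINF_less_iff dist_norm)
  qed
  then obtain w where w: "\<And>n. w n \<in> W" "\<And>n. norm (x - w n) < d + inverse (real (Suc n))"
    by metis
  have lim_norm: "(\<lambda>n. norm (x - w n)) \<longlonglongrightarrow> d"
  proof (rule tendsto_sandwich)
    show "\<forall>\<^sub>F n in sequentially. d \<le> norm (x - w n)"
      using d w by simp
    show "\<forall>\<^sub>F n in sequentially. norm (x - w n) \<le> d + inverse (real (Suc n))"
      using w(2) by (simp only: less_imp_le eventually_True simp_thms)
    show "(\<lambda>n. d + inverse (real (Suc n))) \<longlonglongrightarrow> d"
      using tendsto_add[OF tendsto_const LIMSEQ_inverse_real_of_nat, of d] by simp
  qed simp
  have par: "(norm (w m - w n))\<^sup>2 \<le> 2 * ((norm (x - w m))\<^sup>2 - d\<^sup>2) + 2 * ((norm (x - w n))\<^sup>2 - d\<^sup>2)"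
    for m n
  proof -
    have "(1/2) *\<^sub>R (w m + w n) \<in> W"
      using W(1) w by (intro subspace_scale subspace_add) auto
    then have "d\<^sup>2 \<le> (norm (x - (1/2) *\<^sub>R (w m + w n)))\<^sup>2"
      using d d0 by (intro power_mono) auto
    moreover have "(norm (w m - w n))\<^sup>2 + 4 * (norm (x - (1/2) *\<^sub>R (w m + w n)))\<^sup>2 =
        2 * (norm (x - w m))\<^sup>2 + 2 * (norm (x - w n))\<^sup>2"
      by (simp add: power2_norm_eq_inner inner_diff inner_add inner_commute algebra_simps)
    ultimately show ?thesis
      by argo
  qed
  have "Cauchy w"
  proof (rule CauchyI)
    fix e :: real assume e: "0 < e"
    have "(\<lambda>n. (norm (x - w n))\<^sup>2) \<longlonglongrightarrow> d\<^sup>2"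
      by (intro tendsto_power lim_norm)
    then have "\<forall>\<^sub>F n in sequentially. (norm (x - w n))\<^sup>2 < d\<^sup>2 + e\<^sup>2 / 4"
      using e by (intro order_tendstoD) auto
    then obtain K where K: "\<And>n. K \<le> n \<Longrightarrow> (norm (x - w n))\<^sup>2 < d\<^sup>2 + e\<^sup>2 / 4"
      by (auto simp: eventually_sequentially)
    have "norm (w m - w n) < e" if "K \<le> m" "K \<le> n" for m n
    proof (rule power2_less_imp_less)
      show "(norm (w m - w n))\<^sup>2 < e\<^sup>2"
        using par[of m n] K[OF that(1)] K[OF that(2)] by argo
    qed (use e in simp)
    then show "\<exists>M. \<forall>m\<ge>M. \<forall>n\<ge>M. norm (w m - w n) < e"
      by blast
  qed
  then obtain p where p: "w \<longlonglongrightarrow> p"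
    using Cauchy_convergent by (auto simp: convergent_def)
  have pW: "p \<in> W"
    using closed_sequentially[OF W(2) _ p] w by auto
  have norm_p: "norm (x - p) = d"
    by (rule LIMSEQ_unique[OF _ lim_norm]) (intro tendsto_intros p)
  show thesis
  proof
    show "x - p \<noteq> 0"
      using x pW by auto
    fix u assume u: "u \<in> W"
    show "inner u (x - p) = 0"
    proof (cases "u = 0")
      case False
      \<comment> \<open>this \<open>t\<close> minimizes the distance from \<open>x\<close> to the line \<open>p + t *\<^sub>R u\<close>\<close>
      define t where "t = inner u (x - p) / inner u u"
      have "p + t *\<^sub>R u \<in> W"
        using W(1) pW u by (intro subspace_add subspace_scale)
      then have "(norm (x - p))\<^sup>2 \<le> (norm (x - (p + t *\<^sub>R u)))\<^sup>2"
        using d d0 norm_p by (intro power_mono) auto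
      also have "x - (p + t *\<^sub>R u) = (x - p) - t *\<^sub>R u"
        by simp
      also have "(norm ((x - p) - t *\<^sub>R u))\<^sup>2 = (norm (x - p))\<^sup>2 - 2 * t * inner u (x - p) + t * t * inner u u"
        unfolding power2_norm_eq_inner inner_diff_left inner_diff_right
        by (simp add: inner_commute algebra_simps)
      finally have "2 * t * inner u (x - p) \<le> t * t * inner u u"
        by simp
      also have "t * t * inner u u = t * inner u (x - p)"
        using False by (simp add: t_def)
      finally have "t * inner u (x - p) \<le> 0"
        by simp
      moreover have "t * inner u (x - p) = (inner u (x - p))\<^sup>2 / inner u u"
        by (simp add: t_def power2_eq_square)
      moreover have "0 < inner u u"
        using False by simp
      ultimately have "(inner u (x - p))\<^sup>2 \<le> 0"
        by (metis divide_le_0_iff not_less)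
      then show ?thesis
        by simp
    qed simp
  qed
qed

lemma subspace_closure:
  fixes S :: "'a::real_normed_vector set"
  assumes S: "subspace S"
  shows "subspace (closure S)"
proof (rule subspaceI)
  show "0 \<in> closure S"
    using subspace_0[OF S] closure_subset by blast
  fix x y assume "x \<in> closure S" "y \<in> closure S"
  then obtain u v where "\<And>n. u n \<in> S" "u \<longlonglongrightarrow> x" "\<And>n. v n \<in> S" "v \<longlonglongrightarrow> y"
    unfolding closure_sequential by metis
  then have "(\<lambda>n. u n + v n) \<longlonglongrightarrow> x + y" "\<And>n. u n + v n \<in> S"
    using S by (auto intro: tendsto_add subspace_add)
  then show "x + y \<in> closure S"
    unfolding closure_sequential by (intro exI[of _ "\<lambda>n. u n + v n"]) auto
next
  fix c :: real and x assume "x \<in> closure S"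
  then obtain u where "\<And>n. u n \<in> S" "u \<longlonglongrightarrow> x"
    unfolding closure_sequential by metis
  then have "(\<lambda>n. c *\<^sub>R u n) \<longlonglongrightarrow> c *\<^sub>R x" "\<And>n. c *\<^sub>R u n \<in> S"
    using S by (auto intro: tendsto_scaleR subspace_scale)
  then show "c *\<^sub>R x \<in> closure S"
    unfolding closure_sequential by (intro exI[of _ "\<lambda>n. c *\<^sub>R u n"]) auto
qed

text \<open>In a Hilbert space, totality can be tested on orthogonal vectors.\<close>

lemma closure_span_eq_UNIV_if_orthogonal_trivial:
  fixes S :: "'a::{real_inner, complete_space} set"
  assumes "\<And>z. (\<And>x. x \<in> S \<Longrightarrow> inner x z = 0) \<Longrightarrow> z = 0"
  shows "closure (span S) = UNIV"
proof (rule ccontr)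
  assume "closure (span S) \<noteq> UNIV"
  then obtain z where "z \<noteq> 0" "\<And>w. w \<in> closure (span S) \<Longrightarrow> inner w z = 0"
    using exists_orthogonal_to_proper_closed_subspace[OF subspace_closure[OF subspace_span] closed_closure]
    by metis
  moreover have "S \<subseteq> closure (span S)"
    using span_superset closure_subset by blast
  ultimately show False
    using assms[of z] by blast
qed

section \<open>Functions determined by their integrals over intervals\<close>

text \<open>
  The measures with densities \<open>f\<^sup>+\<close> and \<open>f\<^sup>-\<close> agree on all rays \<open>{c<..}\<close>, hence coincide, and a
  density is determined almost everywhere by its measure. (Truncation of negative values by \<open>ennreal\<close>
  produces the positive parts.)
\<close>

lemma AE_eq_zero_if_all_tail_integrals_zero:
  fixes f :: "real \<Rightarrow> real"
  assumes f: "integrable lborel f"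
    and zero: "\<And>c. (LINT x|lborel. f x * indicator {c<..} x) = 0"
  shows "AE x in lborel. f x = 0"
proof -
  have [measurable]: "f \<in> borel_measurable borel"
    using borel_measurable_integrable[OF f] by simp
  let ?P = "density lborel (\<lambda>x. ennreal (f x))" and ?N = "density lborel (\<lambda>x. ennreal (- f x))"
  have int: "integrable lborel (\<lambda>x. max 0 (f x) * indicator {c<..} x)"
       "integrable lborel (\<lambda>x. max 0 (- f x) * indicator {c<..} x)" for c
    using f by (auto intro!: integrable_real_mult_indicator)
  have P: "emeasure ?P {c<..} = ennreal (LINT x|lborel. max 0 (f x) * indicator {c<..} x)" for c
    by (subst emeasure_density, simp, simp, subst nn_integral_eq_integral[OF int(1), symmetric])
      (auto intro!: nn_integral_cong simp: indicator_def ennreal_neg max_def)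
  have N: "emeasure ?N {c<..} = ennreal (LINT x|lborel. max 0 (- f x) * indicator {c<..} x)" for c
    by (subst emeasure_density, simp, simp, subst nn_integral_eq_integral[OF int(2), symmetric])
      (auto intro!: nn_integral_cong simp: indicator_def ennreal_neg max_def)
  have "?P = ?N"
  proof (rule measure_eqI_lessThan)
    fix c
    show "emeasure ?P {c<..} < \<infinity>"
      unfolding P by simp
    have "(LINT x|lborel. max 0 (f x) * indicator {c<..} x) -
        (LINT x|lborel. max 0 (- f x) * indicator {c<..} x) =
        (LINT x|lborel. f x * indicator {c<..} x)"
      by (subst Bochner_Integration.integral_diff[OF int, symmetric])
        (auto intro!: Bochner_Integration.integral_cong simp: max_def indicator_def)
    then show "emeasure ?P {c<..} = emeasure ?N {c<..}"
      unfolding P N by (simp add: zero)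
  qed auto
  moreover have "(\<integral>\<^sup>+x. ennreal (f x) \<partial>lborel) \<noteq> \<infinity>"
    using real_integrable_def f by (auto simp: top_unique)
  ultimately have "AE x in lborel. ennreal (f x) = ennreal (- f x)"
    by (subst (asm) finite_density_unique) auto
  then show ?thesis
  proof eventually_elim
    case (elim x)
    show ?case
    proof (cases "0 \<le> f x")
      case True
      with elim have "ennreal (f x) = 0"
        by (simp add: ennreal_neg)
      with True show ?thesis
        by (simp add: ennreal_eq_0_iff)
    next
      case False
      with elim have "ennreal (- f x) = 0"
        by (simp add: ennreal_neg)
      with False show ?thesis
        by (simp add: ennreal_eq_0_iff)
    qed
  qed
qed

lemma integrable_Rpos_iff_lborel:
  fixes f :: "real \<Rightarrow> real"
  assumes "f \<in> borel_measurable borel"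
  shows "integrable Rpos f \<longleftrightarrow> integrable lborel (\<lambda>x. indicator {0<..} x * f x)"
  using assms by (subst integrable_restrict_space) (auto simp: integrable_completion)

lemma integral_Rpos_eq_lborel:
  fixes f :: "real \<Rightarrow> real"
  assumes "f \<in> borel_measurable borel"
  shows "(LINT x|Rpos. f x) = (LINT x|lborel. indicator {0<..} x * f x)"
  using assms by (subst integral_restrict_space) (auto simp: integral_completion)

lemma square_integrable_indicator:
  "square_integrable (indicator {..c})"
proof -
  have "emeasure lborel {0<..c} < \<infinity>"
    by (intro emeasure_bounded_finite bounded_subset[OF bounded_closed_interval[of 0 c]]) auto
  then have "integrable lborel (indicator {0<..c} :: real \<Rightarrow> real)"
    by (intro integrable_real_indicator) auto
  also have "(indicator {0<..c} :: real \<Rightarrow> real) = (\<lambda>x. indicator {0<..} x * indicator {..c} x)"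
    by (auto simp: indicator_def)
  finally have "integrable Rpos (indicator {..c} :: real \<Rightarrow> real)"
    by (subst integrable_Rpos_iff_lborel) auto
  moreover have "(indicator {..c} x :: real)\<^sup>2 = indicator {..c} x" for x :: real
    by (simp add: indicator_def)
  ultimately show ?thesis
    by (simp add: square_integrable_def measurable_restrict_space1)
qed

text \<open>
  A square integrable function need be integrable only on bounded sets, so it is replaced by a Borel
  version \<open>g'\<close> and cut off at \<open>n\<close>; the cut-off functions have vanishing integrals over all rays.
\<close>

lemma AE_Rpos_eq_zero_if_initial_integrals_zero:
  assumes g: "square_integrable g"
    and zero: "\<And>c. 0 < c \<Longrightarrow> (LINT x|Rpos. g x * indicator {..c} x) = 0"
  shows "AE x in Rpos. g x = 0"
proof -
  have "(\<lambda>x. g x * indicator {0<..} x) \<in> borel_measurable lebesgue"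
    using g by (simp add: square_integrable_def borel_measurable_restrict_space_iff mult.commute)
  then obtain g' :: "real \<Rightarrow> real" where [measurable]: "g' \<in> borel_measurable lborel"
    and g': "AE x in lborel. g x * indicator {0<..} x = g' x"
    using completion_ex_borel_measurable_real by blast
  have AE_g': "AE x in lebesgue. g x * indicator {0<..} x = g' x"
    using g' by (rule AE_completion)
  have ind: "integrable lborel (\<lambda>x. g' x * indicator {..c} x) \<and>
      (LINT x|lborel. g' x * indicator {..c} x) = (LINT x|Rpos. g x * indicator {..c} x)" for c
  proof -
    have "integrable Rpos (\<lambda>x. g x * indicator {..c} x)"
      by (intro square_integrable_mult g square_integrable_indicator)
    then have int: "integrable lebesgue (\<lambda>x. indicator {0<..} x * (g x * indicator {..c} x))"
      by (subst (asm) integrable_restrict_space) auto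
    have AE: "AE x in lebesgue. indicator {0<..} x * (g x * indicator {..c} x) = g' x * indicator {..c} x"
      using AE_g' by eventually_elim (auto simp: indicator_def)
    have m: "(\<lambda>x. g' x * indicator {..c} x) \<in> borel_measurable lborel"
      by measurable
    have m': "(\<lambda>x. g' x * indicator {..c} x) \<in> borel_measurable lebesgue"
      using m by (rule measurable_completion)
    have "integrable lebesgue (\<lambda>x. g' x * indicator {..c} x)"
      using int by (rule integrable_cong_AE_imp[OF _ m']) (use AE in eventually_elim, simp)
    moreover have "(LINT x|Rpos. g x * indicator {..c} x) = (LINT x|lebesgue. g' x * indicator {..c} x)"
      by (subst integral_restrict_space, simp, rule integral_cong_AE)
        (use AE borel_measurable_integrable[OF int] m' in simp_all)
    ultimately show ?thesis
      using integrable_completion[OF m] integral_completion[OF m] by simp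
  qed
  have zero': "(LINT x|lborel. g' x * indicator {..c} x) = 0" for c
  proof (cases "0 < c")
    case True
    then show ?thesis
      using ind zero by simp
  next
    case False
    have "(LINT x|Rpos. g x * indicator {..c} x) = (LINT x|Rpos. 0)"
      using False by (intro Bochner_Integration.integral_cong) (auto simp: space_restrict_space)
    then show ?thesis
      using ind by simp
  qed
  have "AE x in lborel. g' x * indicator {..real n} x = 0" for n
  proof (rule AE_eq_zero_if_all_tail_integrals_zero)
    show "integrable lborel (\<lambda>x. g' x * indicator {..real n} x)"
      using ind by blast
    fix c
    have "(LINT x|lborel. g' x * indicator {..real n} x * indicator {c<..} x) =
        (LINT x|lborel. g' x * indicator {..real n} x - g' x * indicator {..min c (real n)} x)"
      by (intro Bochner_Integration.integral_cong) (auto simp: indicator_def)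
    also have "\<dots> = 0"
      using ind by (subst Bochner_Integration.integral_diff) (auto simp: zero')
    finally show "(LINT x|lborel. g' x * indicator {..real n} x * indicator {c<..} x) = 0" .
  qed
  then have "AE x in lborel. \<forall>n. g' x * indicator {..real n} x = 0"
    by (intro AE_all_countable[THEN iffD2] allI)
  then have "AE x in lborel. g' x = 0"
  proof eventually_elim
    case (elim x)
    obtain n where "x \<le> real n"
      using real_arch_simple by blast
    with elim show ?case
      by (auto simp: indicator_def split: if_splits)
  qed
  then have "AE x in lebesgue. g' x = 0"
    by (rule AE_completion)
  with AE_g' have "AE x in lebesgue. x \<in> {0<..} \<longrightarrow> g x = 0"
    by eventually_elim (auto simp: indicator_def)
  then show ?thesis
    by (subst AE_restrict_space_iff) auto
qed

section \<open>Truncated powers of the logarithm\<close>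

text \<open>
  The truncated power \<open>(log (c / x))\<^sub>+\<^sup>p\<close>, with the parameter \<open>s = log c\<close>: in this form the family is
  invariant under translations of \<open>s\<close> and \<open>ln x\<close>. The convention \<open>0 powr p = 0\<close> makes it vanish
  for \<open>x \<ge> exp s\<close>, also when \<open>p\<close> is zero or negative.
\<close>

definition log_power :: "real \<Rightarrow> real \<Rightarrow> real \<Rightarrow> real"
  where "log_power p s x = max 0 (s - ln x) powr p"

lemma measurable_log_power [measurable]:
  "log_power p s \<in> borel_measurable borel"
  "log_power p s \<in> borel_measurable Rpos"
proof -
  show "log_power p s \<in> borel_measurable borel"
    unfolding log_power_def[abs_def] by measurable
  then show "log_power p s \<in> borel_measurable Rpos"
    by (intro measurable_restrict_space1 measurable_completion) simp
qed

lemma log_power_nonneg: "0 \<le> log_power p s x"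
  by (simp add: log_power_def)

lemma log_power_1: "log_power 1 s x = max 0 (s - ln x)"
  by (simp add: log_power_def)

lemma square_log_power: "(log_power p s x)\<^sup>2 = log_power (2 * p) s x"
  by (simp add: log_power_def power2_eq_square flip: powr_add)

lemma set_integrable_powr_unit_interval:
  assumes "- 1 < p"
  shows "set_integrable lborel {0<..<1::real} (\<lambda>x. x powr p)"
    and "set_integrable lborel {0<..<1::real} (\<lambda>x. (1 - x) powr p)"
proof -
  have "set_integrable lborel {0<..<1::real} (\<lambda>x. x powr (p + 1 - 1) * (1 - x) powr (1 - 1))"
    by (rule set_integrable_subset[OF integrable_Beta]) (use assms in auto)
  then show "set_integrable lborel {0<..<1::real} (\<lambda>x. x powr p)"
    by (rule set_integrable_cong[THEN iffD1, rotated 3]) auto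
  have "set_integrable lborel {0<..<1::real} (\<lambda>x. x powr (1 - 1) * (1 - x) powr (p + 1 - 1))"
    by (rule set_integrable_subset[OF integrable_Beta]) (use assms in auto)
  then show "set_integrable lborel {0<..<1::real} (\<lambda>x. (1 - x) powr p)"
    by (rule set_integrable_cong[THEN iffD1, rotated 3]) auto
qed

lemma minus_ln_powr_bound:
  fixes x :: real
  assumes "0 < x" "x < 1" "0 < a" "0 \<le> p"
  shows "(- ln x) powr p \<le> x powr (- (a * p)) / a powr p"
proof -
  have "- ln x = ln (1 / x)"
    using ln_inverse[of x] by (simp add: inverse_eq_divide)
  also have "\<dots> \<le> (1 / x) powr a / a"
    using assms by (intro ln_powr_bound) auto
  also have "(1 / x) powr a = x powr (- a)"
    using assms by (simp add: powr_divide powr_minus_divide)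
  finally have "(- ln x) powr p \<le> (x powr (- a) / a) powr p"
    using assms by (intro powr_mono2) auto
  also have "\<dots> = x powr (- (a * p)) / a powr p"
    using assms by (simp add: powr_divide powr_powr)
  finally show ?thesis .
qed

text \<open>
  For \<open>p < 0\<close> the singularity is at \<open>x = 1\<close>, where \<open>- ln x \<ge> 1 - x\<close>; for \<open>p \<ge> 0\<close> it is at \<open>x = 0\<close>,
  where the logarithm is dominated by a small negative power of \<open>x\<close>. The sum of the two bounds
  serves both cases.
\<close>

lemma integrable_log_power_0:
  assumes p: "- 1 < p"
  shows "integrable lborel (\<lambda>x. indicator {0<..} x * log_power p 0 x)"
proof -
  \<comment> \<open>\<open>a\<close> is so small that \<open>\<bar>a * p\<bar> < 1/2\<close>\<close>
  define a where "a = 1 / (2 * \<bar>p\<bar> + 1)"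
  define r where "r = - (a * p)"
  have a: "0 < a"
    by (simp add: a_def)
  have r: "- 1 < r"
    by (simp add: r_def a_def field_simps abs_if)
  have "integrable lborel (\<lambda>x. indicator {0<..<1} x * (1 - x) powr p +
      indicator {0<..<1} x * x powr r / a powr p)"
    using set_integrable_powr_unit_interval[OF p] set_integrable_powr_unit_interval[OF r]
    by (simp add: set_integrable_def)
  then show ?thesis
  proof (rule Bochner_Integration.integrable_bound)
    show "AE x in lborel. norm (indicator {0<..} x * log_power p 0 x)
        \<le> norm (indicator {0<..<1} x * (1 - x) powr p + indicator {0<..<1} x * x powr r / a powr p)"
    proof (rule AE_I2)
      fix x :: real
      show "norm (indicator {0<..} x * log_power p 0 x)
        \<le> norm (indicator {0<..<1} x * (1 - x) powr p + indicator {0<..<1} x * x powr r / a powr p)"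
      proof (cases "0 < x \<and> x < 1")
        case True
        have "(- ln x) powr p \<le> (1 - x) powr p + x powr r / a powr p"
        proof (cases "0 \<le> p")
          case p0: True
          have "(- ln x) powr p \<le> x powr r / a powr p"
            unfolding r_def using True a p0 by (intro minus_ln_powr_bound) auto
          then show ?thesis
            by (simp add: add_increasing)
        next
          case False
          have "(- ln x) powr p \<le> (1 - x) powr p"
            using True False ln_le_minus_one[of x] by (intro powr_mono2') auto
          then show ?thesis
            by (simp add: add_increasing2)
        qed
        with True show ?thesis
          by (simp add: log_power_def max_def)
      next
        case False
        then have "indicator {0<..} x * log_power p 0 x = 0"
          by (auto simp: log_power_def indicator_def max_def)
        then show ?thesis
          by (simp only: norm_zero norm_ge_zero)
      qed
    qed
  qed simp
qed

lemma log_power_rescale: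
  "indicator {0<..} (exp s * x) * log_power p s (exp s * x) = indicator {0<..} x * log_power p 0 x"
  by (auto simp: log_power_def indicator_def ln_mult zero_less_mult_iff)

lemma integrable_log_power:
  assumes "- 1 < p"
  shows "integrable Rpos (log_power p s)"
  using integrable_log_power_0[OF assms]
    lborel_integrable_real_affine_iff[of "exp s" "\<lambda>x. indicator {0<..} x * log_power p s x" 0]
  by (simp add: integrable_Rpos_iff_lborel log_power_rescale)

lemma integral_log_power_scaling:
  "(LINT x|Rpos. log_power p s x) = exp s * (LINT x|Rpos. log_power p 0 x)"
  using lborel_integral_real_affine[of "exp s" "\<lambda>x. indicator {0<..} x * log_power p s x" 0]
  by (simp add: integral_Rpos_eq_lborel log_power_rescale)

lemma square_integrable_log_power:
  assumes "- (1/2) < p"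
  shows "square_integrable (log_power p s)"
  using integrable_log_power[of "2 * p" s] assms
  by (simp add: square_integrable_def square_log_power)

lemma Beta_real_pos: "0 < Beta a b" if "0 < a" "0 < b" for a b :: real
  using that unfolding Beta_def by (intro divide_pos_pos mult_pos_pos Gamma_real_pos add_pos_pos)

text \<open>Euler's Beta integral, transported from the unit interval to \<open>[y, z]\<close> by an affine substitution.\<close>

lemma has_bochner_integral_Beta_convolution:
  fixes a b :: real
  assumes ab: "0 < a" "0 < b"
  shows "has_bochner_integral lborel (\<lambda>v. max 0 (v - y) powr (a - 1) * max 0 (z - v) powr (b - 1))
    (Beta a b * max 0 (z - y) powr (a + b - 1))"
proof (cases "y < z")
  case True
  define L where "L = z - y"
  have L: "0 < L"
    using True by (simp add: L_def)
  have "0 \<le> Beta a b"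
    using Beta_real_pos[OF ab] by simp
  have "(\<integral>\<^sup>+t. ennreal (max 0 t powr (a - 1) * max 0 (1 - t) powr (b - 1)) \<partial>lborel) = ennreal (Beta a b)"
  proof -
    have "(\<integral>\<^sup>+t. ennreal (indicator {0..1} t * (t powr (a - 1) * (1 - t) powr (b - 1))) \<partial>lborel) = ennreal (Beta a b)"
      by (rule nn_integral_has_integral_lebesgue[OF _ has_integral_Beta_real[OF ab]]) simp
    then show ?thesis
      by (rule back_subst[where P = "\<lambda>I. I = _"])
        (auto intro!: nn_integral_cong simp: indicator_def max_def)
  qed
  then have beta: "has_bochner_integral lborel (\<lambda>t. max 0 t powr (a - 1) * max 0 (1 - t) powr (b - 1)) (Beta a b)"
    using \<open>0 \<le> Beta a b\<close> by (intro has_bochner_integral_nn_integral) auto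
  define f where "f v = max 0 (v - y) powr (a - 1) * max 0 (z - v) powr (b - 1)" for v
  have [measurable]: "f \<in> borel_measurable borel"
    unfolding f_def by measurable
  have f: "f (y + L * t) = L powr (a + b - 2) * (max 0 t powr (a - 1) * max 0 (1 - t) powr (b - 1))" for t
  proof -
    have "max 0 (y + L * t - y) = L * max 0 t"
      using L by (simp add: max_def mult_le_0_iff zero_le_mult_iff)
    moreover have "max 0 (z - (y + L * t)) = L * max 0 (1 - t)"
    proof -
      have "z - (y + L * t) = L * (1 - t)"
        by (simp add: L_def algebra_simps)
      then show ?thesis
        using L by (simp add: max_def zero_le_mult_iff)
    qed
    moreover have "L powr (a + b - 2) = L powr (a - 1) * L powr (b - 1)"
      by (simp flip: powr_add)
    ultimately show ?thesis
      unfolding f_def by (simp only: powr_mult mult.assoc mult.left_commute)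
  qed
  have "has_bochner_integral lborel (\<lambda>t. f (y + L * t)) (L powr (a + b - 2) * Beta a b)"
    unfolding f by (intro has_bochner_integral_mult_right beta)
  then have "has_bochner_integral lborel f (\<bar>L\<bar> *\<^sub>R (L powr (a + b - 2) * Beta a b))"
    using L lborel_integrable_real_affine_iff[of L f y] lborel_integral_real_affine[of L f y]
    by (simp add: has_bochner_integral_iff)
  moreover have "L * L powr (a + b - 2) = L powr (a + b - 1)"
    using L by (simp add: powr_mult_base)
  ultimately show ?thesis
    using L by (simp add: f_def[abs_def] L_def mult.commute mult.left_commute)
next
  case False
  have "(\<lambda>v. max 0 (v - y) powr (a - 1) * max 0 (z - v) powr (b - 1)) = (\<lambda>v. 0)"
    using False by (auto simp: max_def)
  with False show ?thesis
    by (simp add: max_def has_bochner_integral_zero)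
qed

section \<open>Totality of the truncated logarithmic powers\<close>

lemma sigma_finite_Rpos: "sigma_finite_measure Rpos"
proof (rule sigma_finite_measure_restrict_space)
  show "sigma_finite_measure (lebesgue :: real measure)"
  proof
    obtain A :: "real set set" where A: "countable A" "A \<subseteq> sets lborel" "\<Union>A = space lborel"
      "\<forall>a\<in>A. emeasure lborel a \<noteq> \<infinity>"
      using lborel.sigma_finite_countable by blast
    then show "\<exists>A::real set set. countable A \<and> A \<subseteq> sets lebesgue \<and> \<Union>A = space lebesgue \<and>
        (\<forall>a\<in>A. emeasure lebesgue a \<noteq> \<infinity>)"
      by (intro exI[of _ A]) auto
  qed
qed simp

text \<open>
  The semigroup law of fractional integration in the parameter \<open>s\<close>: integrating the powers of
  exponent \<open>a - 1\<close> against \<open>(s - v)\<^sub>+\<^bsup>b - 1\<^esup>\<close> over \<open>v\<close> yields, up to the factor \<open>Beta a b\<close>, the power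
  of exponent \<open>a + b - 1\<close>. By Fubini's theorem orthogonality to the former passes to the latter. All
  factors except \<open>g\<close> are nonnegative, so the same identity for \<open>\<bar>g\<bar>\<close> supplies the integrability
  that Fubini's theorem requires; \<open>a > 1/2\<close> makes the powers square integrable.
\<close>

lemma integral_log_power_semigroup:
  assumes g: "square_integrable g" and ab: "1/2 < a" "0 < b"
    and zero: "\<And>s. (LINT x|Rpos. log_power (a - 1) s x * g x) = 0"
  shows "(LINT x|Rpos. log_power (a + b - 1) s x * g x) = 0"
proof -
  interpret Rpos: sigma_finite_measure Rpos
    by (rule sigma_finite_Rpos)
  interpret pair_sigma_finite Rpos lborel ..
  have [measurable]: "g \<in> borel_measurable Rpos"
    using g by (simp add: square_integrable_def)
  have [measurable]: "(ln :: real \<Rightarrow> real) \<in> borel_measurable Rpos"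
    by (intro measurable_restrict_space1 measurable_completion) simp
  define w where "w v = max 0 (s - v) powr (b - 1)" for v
  have [measurable]: "w \<in> borel_measurable lborel"
    unfolding w_def by measurable
  define F where "F x v = log_power (a - 1) v x * w v * g x" for x v
  have conv: "has_bochner_integral lborel (\<lambda>v. log_power (a - 1) v x * w v)
      (Beta a b * log_power (a + b - 1) s x)" for x
    unfolding log_power_def w_def
    using has_bochner_integral_Beta_convolution[of a b "ln x" s] ab by simp
  have F_v: "has_bochner_integral lborel (F x) (Beta a b * log_power (a + b - 1) s x * g x)" for x
    unfolding F_def by (intro has_bochner_integral_mult_left conv)
  have normF_v: "(LINT v|lborel. norm (F x v)) = Beta a b * log_power (a + b - 1) s x * \<bar>g x\<bar>" for x
  proof (rule has_bochner_integral_integral_eq)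
    have "norm (F x v) = log_power (a - 1) v x * w v * \<bar>g x\<bar>" for v
      by (simp add: F_def abs_mult log_power_def w_def)
    then show "has_bochner_integral lborel (\<lambda>v. norm (F x v)) (Beta a b * log_power (a + b - 1) s x * \<bar>g x\<bar>)"
      by (simp only:) (intro has_bochner_integral_mult_left conv)
  qed
  have sq: "square_integrable (log_power (a + b - 1) s)"
    using ab by (intro square_integrable_log_power) simp
  have "integrable (Rpos \<Otimes>\<^sub>M lborel) (case_prod F)"
  proof (rule Fubini_integrable)
    show "case_prod F \<in> borel_measurable (Rpos \<Otimes>\<^sub>M lborel)"
      unfolding F_def log_power_def split_beta' by measurable
    have "integrable Rpos (\<lambda>x. \<bar>log_power (a + b - 1) s x * g x\<bar>)"
      by (intro integrable_abs square_integrable_mult sq g)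
    then show "integrable Rpos (\<lambda>x. LINT v|lborel. norm (case_prod F (x, v)))"
      unfolding split_conv normF_v by (simp add: abs_mult log_power_nonneg mult.assoc)
    show "AE x in Rpos. integrable lborel (\<lambda>v. case_prod F (x, v))"
      using F_v by (auto simp: has_bochner_integral_iff)
  qed
  from Fubini_integral[OF this]
  have "(LINT x|Rpos. Beta a b * log_power (a + b - 1) s x * g x) = (LINT v|lborel. LINT x|Rpos. F x v)"
    using F_v by (simp add: has_bochner_integral_iff)
  also have "\<dots> = (LINT v|lborel. w v * (LINT x|Rpos. log_power (a - 1) v x * g x))"
    unfolding F_def mult.assoc mult.left_commute[of "log_power _ _ _" "w _"] by simp
  also have "\<dots> = 0"
    by (simp add: zero)
  finally have "Beta a b * (LINT x|Rpos. log_power (a + b - 1) s x * g x) = 0"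
    by (simp add: mult.assoc)
  moreover have "Beta a b \<noteq> 0"
    using Beta_real_pos[of a b] ab by simp
  ultimately show ?thesis
    by simp
qed

text \<open>
  The difference quotients of \<open>(s - ln x)\<^sub>+\<close> in \<open>s\<close>, with positive increments at most \<open>1\<close>, lie between
  \<open>0\<close> and \<open>1\<close>, vanish for \<open>x > exp (s + 1)\<close>, and converge to the indicator of \<open>x \<le> exp s\<close>.
\<close>

lemma initial_integral_zero_if_log_integrals_zero:
  assumes g: "square_integrable g"
    and zero: "\<And>s. (LINT x|Rpos. log_power 1 s x * g x) = 0"
    and c: "0 < c"
  shows "(LINT x|Rpos. g x * indicator {..c} x) = 0"
proof -
  have [measurable]: "g \<in> borel_measurable Rpos"
    using g by (simp add: square_integrable_def)
  have [measurable]: "(indicator {..c} :: real \<Rightarrow> real) \<in> borel_measurable Rpos" for c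
    using square_integrable_indicator by (simp add: square_integrable_def)
  define s where "s = ln c"
  define h where "h n = inverse (real (Suc n))" for n
  have h: "0 < h n" "h n \<le> 1" for n
    by (simp_all add: h_def field_simps)
  have h0: "h \<longlonglongrightarrow> 0"
    unfolding h_def by (rule LIMSEQ_inverse_real_of_nat)
  define Q where "Q n x = (log_power 1 (s + h n) x - log_power 1 s x) / h n" for n x
  have Q: "(\<lambda>n. Q n x) \<longlonglongrightarrow> indicator {..c} x" if x: "0 < x" for x
  proof (cases "x \<le> c")
    case True
    then have "ln x \<le> s"
      using x by (simp add: s_def)
    then have "Q n x = 1" for n
      using h[of n] by (simp add: Q_def log_power_1 max_def)
    with True show ?thesis
      by simp
  next
    case False
    then have "0 < ln x - s"
      using x c by (simp add: s_def)
    then have "\<forall>\<^sub>F n in sequentially. h n < ln x - s"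
      by (rule order_tendstoD(2)[OF h0])
    then have "\<forall>\<^sub>F n in sequentially. Q n x = 0"
      by eventually_elim (use \<open>0 < ln x - s\<close> in \<open>simp add: Q_def log_power_1 max_def\<close>)
    with False show ?thesis
      by (simp add: tendsto_eventually)
  qed
  have Q_bound: "\<bar>Q n x\<bar> \<le> indicator {..exp (s + 1)} x" if x: "0 < x" for n x
  proof (cases "ln x \<le> s + 1")
    case True
    then have "x \<le> exp (s + 1)"
      using x ln_le_cancel_iff[of x "exp (s + 1)"] by simp
    moreover have "\<bar>log_power 1 (s + h n) x - log_power 1 s x\<bar> \<le> h n"
      using h[of n] by (simp add: log_power_1 max_def)
    ultimately show ?thesis
      using h[of n] by (simp add: Q_def divide_le_eq_1)
  next
    case False
    then show ?thesis
      using h[of n] by (simp add: Q_def log_power_1 max_def)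
  qed
  have "(\<lambda>n. LINT x|Rpos. g x * Q n x) \<longlonglongrightarrow> (LINT x|Rpos. g x * indicator {..c} x)"
  proof (rule integral_dominated_convergence)
    show "integrable Rpos (\<lambda>x. \<bar>g x * indicator {..exp (s + 1)} x\<bar>)"
      by (intro integrable_abs square_integrable_mult g square_integrable_indicator)
    show "AE x in Rpos. (\<lambda>n. g x * Q n x) \<longlonglongrightarrow> g x * indicator {..c} x"
      by (intro AE_I2 tendsto_mult tendsto_const Q) (simp add: space_restrict_space)
    show "AE x in Rpos. norm (g x * Q n x) \<le> \<bar>g x * indicator {..exp (s + 1)} x\<bar>" for n
      using Q_bound by (intro AE_I2) (auto simp: space_restrict_space abs_mult intro!: mult_left_mono)
  qed (unfold Q_def, measurable)
  moreover have "(LINT x|Rpos. g x * Q n x) = 0" for n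
  proof -
    have int: "integrable Rpos (\<lambda>x. log_power 1 t x * g x)" for t
      by (intro square_integrable_mult g square_integrable_log_power) simp
    have "(LINT x|Rpos. g x * Q n x) =
        (LINT x|Rpos. (log_power 1 (s + h n) x * g x - log_power 1 s x * g x) / h n)"
      by (simp add: Q_def algebra_simps)
    also have "\<dots> = 0"
      using int by (simp add: zero)
    finally show ?thesis .
  qed
  ultimately show ?thesis
    by (simp add: LIMSEQ_const_iff)
qed

text \<open>
  The exponent \<open>p\<close> is raised to \<open>1\<close> by a fractional integration of order \<open>1 - p\<close>. Aiming directly at
  exponent \<open>0\<close>, that is at indicators, would need a fractional derivative when \<open>p > 0\<close>.
\<close>

lemma log_powers_total:
  assumes g: "square_integrable g" and p: "- (1/2) < p" "p < 1"
    and zero: "\<And>s. (LINT x|Rpos. log_power p s x * g x) = 0"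
  shows "AE x in Rpos. g x = 0"
proof (rule AE_Rpos_eq_zero_if_initial_integrals_zero[OF g])
  have "(LINT x|Rpos. log_power 1 s x * g x) = 0" for s
    using integral_log_power_semigroup[OF g, of "p + 1" "1 - p" s] p zero by simp
  then show "(LINT x|Rpos. g x * indicator {..c} x) = 0" if "0 < c" for c
    by (rule initial_integral_zero_if_log_integrals_zero[OF g _ that])
qed

section \<open>The operator on indicators of intervals\<close>

text \<open>
  The kernel has the antiderivative \<open>ln (z / t) powr \<delta> / \<delta>\<close> in \<open>z\<close>. It may be singular at \<open>z = t\<close>, so the
  fundamental theorem is used in its improper form for nonnegative integrands.
\<close>

lemma hadamard_integral_indicator:
  assumes \<delta>: "0 < \<delta>" and ab: "0 < a" "a < b" and t: "0 < t"
  shows "hadamard_integral \<delta> (indicat_real {a<..<b}) t =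
    (log_power \<delta> (ln b) t - log_power \<delta> (ln a) t) / Gamma (\<delta> + 1)"
proof -
  define f where "f z = ln (z / t) powr (\<delta> - 1) / z" for z
  define F where "F z = ln (z / t) powr \<delta> / \<delta>" for z
  \<comment> \<open>the integrand lives on \<open>(A, b)\<close>, and \<open>ln (A / t)\<close> is the positive part of \<open>ln (a / t)\<close>\<close>
  define A where "A = max a t"
  have [measurable]: "f \<in> borel_measurable borel"
    unfolding f_def by measurable
  have A: "0 < A" "t \<le> A"
    using t by (auto simp: A_def)
  have "(LINT z:{t<..}|lebesgue. ln (z / t) powr (\<delta> - 1) * (indicat_real {a<..<b} z / z)) =
      (LINT z|lebesgue. indicator {A<..<b} z * f z)"
    unfolding set_lebesgue_integral_def
    by (intro Bochner_Integration.integral_cong) (auto simp: indicator_def A_def f_def)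
  also have "\<dots> = (LINT z|lborel. indicator {A<..<b} z * f z)"
    by (intro integral_completion) measurable
  also have "\<dots> = (log_power \<delta> (ln b) t - log_power \<delta> (ln a) t) / \<delta>"
  proof (cases "A < b")
    case True
    have F_right: "(F \<longlongrightarrow> F A) (at_right A)"
    proof -
      have "\<forall>\<^sub>F x in at_right A. 0 \<le> ln (x / t)"
        using A t by (intro eventually_at_right_less[THEN eventually_mono]) auto
      then show ?thesis
        unfolding F_def using A t \<delta>
        by (intro tendsto_divide tendsto_powr' tendsto_ln tendsto_const tendsto_ident_at) auto
    qed
    have F_left: "(F \<longlongrightarrow> F b) (at_left b)"
      unfolding F_def using A True t \<delta>
      by (intro tendsto_divide tendsto_powr tendsto_ln tendsto_const tendsto_ident_at) auto
    have "(LBINT z=ereal A..ereal b. f z) = F b - F A"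
    proof (rule interval_integral_FTC_nonneg(2))
      fix z assume "ereal A < ereal z" "ereal z < ereal b"
      then have z: "t < z" "0 < ln (z / t)"
        using A t by auto
      show "DERIV F z :> f z"
        unfolding F_def f_def using z t \<delta>
        by (auto intro!: derivative_eq_intros simp: powr_diff)
      show "isCont f z"
        unfolding f_def using z t by (intro continuous_intros) auto
    next
      show "((F \<circ> real_of_ereal) \<longlongrightarrow> F A) (at_right (ereal A))"
        by (simp add: ereal_tendsto_simps F_right)
      show "((F \<circ> real_of_ereal) \<longlongrightarrow> F b) (at_left (ereal b))"
        by (simp add: ereal_tendsto_simps F_left)
      show "AE z in lborel. ereal A < ereal z \<longrightarrow> ereal z < ereal b \<longrightarrow> 0 \<le> f z"
        using A by (auto simp: f_def)
    qed (use True in simp)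
    also have "(LBINT z=ereal A..ereal b. f z) = (LINT z|lborel. indicator {A<..<b} z * f z)"
      using True by (simp add: interval_lebesgue_integral_def set_lebesgue_integral_def einterval_def
          greaterThanLessThan_def greaterThan_def lessThan_def Int_def)
    also have "F b - F A = (log_power \<delta> (ln b) t - log_power \<delta> (ln a) t) / \<delta>"
      using True ab t A by (auto simp: F_def log_power_def A_def ln_div max_def diff_divide_distrib)
    finally show ?thesis .
  next
    case False
    then have "b \<le> t"
      using ab by (auto simp: A_def max_def split: if_splits)
    with False ab t show ?thesis
      by (simp add: log_power_def max_def)
  qed
  finally have "(LINT z:{t<..}|lebesgue. ln (z / t) powr (\<delta> - 1) * (indicat_real {a<..<b} z / z)) =
      (log_power \<delta> (ln b) t - log_power \<delta> (ln a) t) / \<delta>" .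
  moreover have "Gamma (\<delta> + 1) = \<delta> * Gamma \<delta>"
    using \<delta> by (intro Gamma_plus1) (auto elim!: nonpos_Ints_cases)
  ultimately show ?thesis
    by (simp add: hadamard_integral_def)
qed

lemma has_real_derivative_log_power:
  assumes "0 < t" "ln t \<noteq> s"
  shows "(log_power p s has_real_derivative - (p / t) * log_power (p - 1) s t) (at t)"
proof (cases "ln t < s")
  case True
  have "((\<lambda>x. (s - ln x) powr p) has_real_derivative - (p / t) * log_power (p - 1) s t) (at t)"
    using assms True by (auto intro!: derivative_eq_intros simp: log_power_def powr_diff field_simps)
  then show ?thesis
  proof (rule has_field_derivative_transform_within_open)
    show "open {0<..<exp s}" by simp
    show "t \<in> {0<..<exp s}"
      using assms True by (metis exp_less_cancel_iff exp_ln greaterThanLessThan_iff)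
    show "(s - ln x) powr p = log_power p s x" if "x \<in> {0<..<exp s}" for x
      using that ln_less_cancel_iff[of x "exp s"] by (simp add: log_power_def)
  qed
next
  case False
  have "((\<lambda>x. 0) has_real_derivative - (p / t) * log_power (p - 1) s t) (at t)"
    using False by (simp add: log_power_def)
  then show ?thesis
  proof (rule has_field_derivative_transform_within_open)
    show "open {exp s<..}" by simp
    show "t \<in> {exp s<..}"
      using assms False by (metis exp_less_cancel_iff exp_ln greaterThan_iff linorder_neqE)
    show "0 = log_power p s x" if "x \<in> {exp s<..}" for x
      using that ln_less_cancel_iff[of "exp s" x] less_trans[OF exp_gt_zero, of s x]
      by (simp add: log_power_def)
  qed
qed

text \<open>
  With \<open>\<gamma> = (\<alpha> - 1) / 2\<close>, the derivative of order \<open>- \<gamma>\<close> applies \<open>- t d/dt\<close> to an integral of order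
  \<open>\<gamma> + 1\<close>, which lowers the exponent to \<open>\<gamma>\<close>, whereas the integral of order \<open>\<gamma>\<close> has this exponent
  from the start. The normalizing constants agree in both regimes.
\<close>

lemma hadamard_M_indicator:
  assumes \<alpha>: "\<alpha> \<in> {0<..<1} \<union> {1<..<2}" and ab: "0 < a" "a < b"
    and t: "0 < t" "t \<noteq> a" "t \<noteq> b"
  shows "hadamard_M \<alpha> (indicat_real {a<..<b}) t =
    1 / sqrt (Gamma \<alpha>) * (log_power ((\<alpha> - 1) / 2) (ln b) t - log_power ((\<alpha> - 1) / 2) (ln a) t)"
proof -
  define \<gamma> where "\<gamma> = (\<alpha> - 1) / 2"
  have \<gamma>1: "(\<alpha> + 1) / 2 = \<gamma> + 1" "0 < \<gamma> + 1"
    using \<alpha> by (auto simp: \<gamma>_def field_simps)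
  have G: "Gamma (\<gamma> + 1) \<noteq> 0"
    using Gamma_real_pos[OF \<gamma>1(2)] by (rule less_imp_neq[symmetric])
  show ?thesis
  proof (cases "\<alpha> < 1")
    case True
    have \<beta>: "1 - (1 - \<alpha>) / 2 = \<gamma> + 1"
      by (simp add: \<gamma>_def field_simps)
    have "((\<lambda>x. (log_power (\<gamma> + 1) (ln b) x - log_power (\<gamma> + 1) (ln a) x) / Gamma (\<gamma> + 1 + 1))
        has_real_derivative (- ((\<gamma> + 1) / t) * log_power (\<gamma> + 1 - 1) (ln b) t -
          - ((\<gamma> + 1) / t) * log_power (\<gamma> + 1 - 1) (ln a) t) / Gamma (\<gamma> + 1 + 1)) (at t)"
      using ab t by (intro DERIV_cdivide DERIV_diff has_real_derivative_log_power) auto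
    then have "(hadamard_integral (\<gamma> + 1) (indicat_real {a<..<b})
        has_real_derivative (- ((\<gamma> + 1) / t) * log_power (\<gamma> + 1 - 1) (ln b) t -
          - ((\<gamma> + 1) / t) * log_power (\<gamma> + 1 - 1) (ln a) t) / Gamma (\<gamma> + 1 + 1)) (at t)"
      by (rule has_field_derivative_transform_within_open[where S = "{0<..}"])
        (use ab t \<gamma>1 in \<open>simp_all add: hadamard_integral_indicator\<close>)
    then have deriv: "deriv (hadamard_integral (\<gamma> + 1) (indicat_real {a<..<b})) t =
        - ((\<gamma> + 1) / t) * (log_power \<gamma> (ln b) t - log_power \<gamma> (ln a) t) / Gamma (\<gamma> + 1 + 1)"
      by (simp add: DERIV_imp_deriv algebra_simps)
    have "Gamma (\<gamma> + 1 + 1) = (\<gamma> + 1) * Gamma (\<gamma> + 1)"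
      using \<gamma>1 by (intro Gamma_plus1) (auto elim!: nonpos_Ints_cases)
    then show ?thesis
      using True t G \<gamma>1(2) unfolding hadamard_M_def hadamard_derivative_def hadamard_const_def \<beta> deriv \<gamma>1(1) \<gamma>_def[symmetric]
      by simp
  next
    case False
    then have "0 < \<gamma>"
      using \<alpha> by (auto simp: \<gamma>_def)
    then show ?thesis
      using False G ab t unfolding hadamard_M_def hadamard_const_def \<gamma>1(1) \<gamma>_def[symmetric]
      by (simp add: hadamard_integral_indicator)
  qed
qed

lemma AE_Rpos_notin_countable:
  assumes "countable X"
  shows "AE x in Rpos. x \<notin> X"
proof -
  have "AE x in lborel. x \<notin> X"
    using countable_imp_null_set_lborel[OF assms] by (rule AE_not_in)
  then have "AE x in lebesgue. x \<notin> X"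
    by (rule AE_completion)
  then show ?thesis
    by (subst AE_restrict_space_iff) (auto elim: eventually_mono)
qed

lemma
  assumes \<alpha>: "\<alpha> \<in> {0<..<1} \<union> {1<..<2}" and ab: "0 < a" "a < b"
  shows square_integrable_hadamard_M_indicator:
      "square_integrable (hadamard_M \<alpha> (indicat_real {a<..<b}))"
    and hadamard_M_indicator_AE: "AE x in Rpos. hadamard_M \<alpha> (indicat_real {a<..<b}) x =
      1 / sqrt (Gamma \<alpha>) * (log_power ((\<alpha> - 1) / 2) (ln b) x - log_power ((\<alpha> - 1) / 2) (ln a) x)"
proof -
  let ?f = "\<lambda>x. 1 / sqrt (Gamma \<alpha>) * (log_power ((\<alpha> - 1) / 2) (ln b) x - log_power ((\<alpha> - 1) / 2) (ln a) x)"
  let ?M = "hadamard_M \<alpha> (indicat_real {a<..<b})"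
  have f: "square_integrable ?f"
    using \<alpha> by (intro square_integrable_scale square_integrable_diff square_integrable_log_power) auto
  have eq: "?f x = ?M x" if "x \<in> space Rpos" "x \<notin> {a, b}" for x
    using that hadamard_M_indicator[OF \<alpha> ab, of x] by (simp add: space_restrict_space)
  have "AE x in Rpos. x \<notin> {a, b}"
    by (rule AE_Rpos_notin_countable) simp
  then show AE: "AE x in Rpos. ?M x = ?f x"
    by (rule AE_mp) (use eq in auto)
  have sets: "{x} \<in> sets Rpos" if "x \<in> {a, b}" for x
    using that ab by (auto simp: sets_restrict_space_iff)
  have [measurable]: "?M \<in> borel_measurable Rpos"
    by (rule measurable_discrete_difference[of ?f _ _ "{a, b}"])
      (use f eq sets in \<open>auto simp: square_integrable_def\<close>)
  have "integrable Rpos (\<lambda>x. (?f x)\<^sup>2)"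
    using f by (simp only: square_integrable_def)
  then have "integrable Rpos (\<lambda>x. (?M x)\<^sup>2)"
  proof (rule integrable_cong_AE_imp)
    show "AE x in Rpos. (?f x)\<^sup>2 = (?M x)\<^sup>2"
      using AE by eventually_elim simp
  qed measurable
  then show "square_integrable ?M"
    by (simp add: square_integrable_def)
qed

section \<open>Density of the image of the indicators\<close>

text \<open>
  The inner product with \<open>log_power p s\<close> is constant in \<open>s\<close>, and it is bounded by a multiple of
  \<open>exp (s / 2)\<close> because of the dilation \<open>x \<mapsto> exp s * x\<close>. Letting \<open>s\<close> tend to \<open>-\<infinity>\<close> shows that it is zero.
\<close>

lemma orthogonal_log_powers_if_orthogonal_differences:
  assumes p: "- (1/2) < p"
    and diff: "\<And>s t. s < t \<Longrightarrow> inner (L2_class (log_power p t)) z = inner (L2_class (log_power p s)) z"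
  shows "inner (L2_class (log_power p s)) z = 0"
proof -
  define N where "N = (LINT x|Rpos. log_power (2 * p) 0 x) * (norm z)\<^sup>2"
  have sq: "square_integrable (log_power p t)" for t
    by (rule square_integrable_log_power[OF p])
  have const: "inner (L2_class (log_power p t)) z = inner (L2_class (log_power p s)) z" for t
    using diff[of s t] diff[of t s] by (cases s t rule: linorder_cases) auto
  have bound: "(inner (L2_class (log_power p s)) z)\<^sup>2 \<le> exp t * N" for t
  proof -
    have "(inner (L2_class (log_power p t)) z)\<^sup>2 \<le> (norm (L2_class (log_power p t)) * norm z)\<^sup>2"
      using Cauchy_Schwarz_ineq2 by (rule power2_le_iff_abs_le[THEN iffD2, rotated]) simp
    also have "\<dots> = exp t * N"
      by (simp add: power_mult_distrib norm_L2_class sq square_log_power N_def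
          integral_log_power_scaling[of _ t])
    finally show ?thesis
      unfolding const[of t] .
  qed
  have "(inner (L2_class (log_power p s)) z)\<^sup>2 \<le> 0"
  proof (rule tendsto_lowerbound)
    show "((\<lambda>t. exp t * N) \<longlongrightarrow> 0) at_bot"
      by (intro tendsto_mult_left_zero exp_at_bot)
    show "\<forall>\<^sub>F t in at_bot. (inner (L2_class (log_power p s)) z)\<^sup>2 \<le> exp t * N"
      using bound by simp
  qed simp
  then show ?thesis
    by simp
qed

theorem theorem7p1:
  fixes \<alpha> :: real
  assumes "\<alpha> \<in> {0<..<1} \<union> {1<..<2}"
  shows "(\<forall>a b. 0 < a \<and> a < b \<longrightarrow> square_integrable (hadamard_M \<alpha> (indicat_real {a<..<b}))) \<and>
    closure (span {L2_class (hadamard_M \<alpha> (indicat_real {a<..<b})) | a b. 0 < a \<and> a < b}) = UNIV"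
proof (intro conjI allI impI)
  show "square_integrable (hadamard_M \<alpha> (indicat_real {a<..<b}))" if "0 < a \<and> a < b" for a b
    using that by (intro square_integrable_hadamard_M_indicator[OF assms]) auto
  define p where "p = (\<alpha> - 1) / 2"
  have p: "- (1/2) < p" "p < 1"
    using assms by (auto simp: p_def)
  have k: "1 / sqrt (Gamma \<alpha>) \<noteq> 0"
  proof -
    have "0 < Gamma \<alpha>"
      using assms by (intro Gamma_real_pos) auto
    then show ?thesis
      by (simp only: real_sqrt_eq_0_iff divide_eq_0_iff less_imp_neq[symmetric]) simp
  qed
  have sq: "square_integrable (log_power p s)" for s
    by (rule square_integrable_log_power[OF p(1)])
  show "closure (span {L2_class (hadamard_M \<alpha> (indicat_real {a<..<b})) | a b. 0 < a \<and> a < b}) = UNIV"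
  proof (rule closure_span_eq_UNIV_if_orthogonal_trivial)
    fix z
    assume orth: "\<And>x. x \<in> {L2_class (hadamard_M \<alpha> (indicat_real {a<..<b})) | a b. 0 < a \<and> a < b} \<Longrightarrow>
      inner x z = 0"
    have "inner (L2_class (log_power p t)) z = inner (L2_class (log_power p s)) z" if "s < t" for s t
    proof -
      have ab: "0 < exp s" "exp s < exp t"
        using that by auto
      have "L2_class (hadamard_M \<alpha> (indicat_real {exp s<..<exp t})) =
          L2_class (\<lambda>x. 1 / sqrt (Gamma \<alpha>) * (log_power p t x - log_power p s x))"
        using square_integrable_hadamard_M_indicator[OF assms ab] hadamard_M_indicator_AE[OF assms ab]
        by (intro L2_class_eqI square_integrable_scale square_integrable_diff sq) (auto simp: p_def)
      also have "\<dots> = (1 / sqrt (Gamma \<alpha>)) *\<^sub>R (L2_class (log_power p t) - L2_class (log_power p s))"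
        by (simp only: L2_class_diff L2_class_scale square_integrable_diff sq)
      finally have "inner ((1 / sqrt (Gamma \<alpha>)) *\<^sub>R (L2_class (log_power p t) - L2_class (log_power p s))) z = 0"
        using ab orth by (metis (mono_tags, lifting) mem_Collect_eq)
      then show ?thesis
        using k by (simp add: inner_diff_left)
    qed
    then have log_orth: "inner (L2_class (log_power p s)) z = 0" for s
      by (rule orthogonal_log_powers_if_orthogonal_differences[OF p(1)])
    define g where "g = L2_rep z"
    have g: "square_integrable g" and z: "z = L2_class g"
      by (simp_all add: g_def square_integrable_L2_rep L2_class_L2_rep)
    have "AE x in Rpos. g x = 0"
    proof (rule log_powers_total[OF g p])
      show "(LINT x|Rpos. log_power p s x * g x) = 0" for s
        using log_orth[of s] by (simp add: z inner_L2_class sq g)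
    qed
    then have "(norm z)\<^sup>2 = (LINT x|Rpos. 0)"
      unfolding z norm_L2_class[OF g]
      using g by (intro integral_cong_AE) (auto simp: square_integrable_def)
    then show "z = 0"
      by simp
  qed
qed

end
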